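(* The function $(I,J)\mapsto \operatorname{dist}(I,J)$ is a metric on the set of non-zero finitely generated monomial ideals of $R=A[\mathbb{M}^1_{\geq 0}\times\cdots\times\mathbb{M}^d_{\geq 0}]$.
   Context: $A$ is a non-zero commutative ring with identity, $d$ is a positive integer, and $\mathbb{M}^1,\ldots,\mathbb{M}^d$ are non-zero additive subgroups of $\mathbb{R}$. Set $\mathbb{M}^i_{\geq 0}=\{m\in\mathbb{M}^i\mid m\geq 0\}$. The semigroup ring $R=A[\mathbb{M}^1_{\geq 0}\times\cdots\times\mathbb{M}^d_{\geq 0}]$ is the set of all finite $A$-linear combinations of monomials $\underline{X}^{\underline{m}}=X_1^{m_1}\cdots X_d^{m_d}$ with $\underline{m}=(m_1,\ldots,m_d)\in\mathbb{M}^1_{\geq 0}\times\cdots\times\mathbb{M}^d_{\geq 0}$ (multiplication adds exponents). A monomial ideal of $R$ is an ideal generated by a (possibly empty) set of monomials. For monomial ideals $I,J$ of $R$ and a real number $\varepsilon>0$, one says "$\operatorname{dist}(I,J)<\varepsilon$" if (1) for every monomial $\underline{X}^{\underline{\gamma}}\in I$ there exists a monomial $\underline{X}^{\underline{\delta}}\in J$ with $|\underline{\gamma}-\underline{\delta}|<\varepsilon$, and (2) for every monomial $\underline{X}^{\underline{\delta}'}\in J$ there exists a monomial $\underline{X}^{\underline{\gamma}'}\in I$ with $|\underline{\delta}'-\underline{\gamma}'|<\varepsilon$. Here $|\underline{\gamma}-\underline{\delta}|=\sqrt{(\gamma_1-\delta_1)^2+\cdots+(\gamma_d-\delta_d)^2}$.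 The distance is then defined as $$\operatorname{dist}(I,J)=\inf\{\varepsilon>0\mid \text{conditions (1) and (2) hold for } I,J,\varepsilon\}.$$ *)

theory Defs
  imports "HOL-Analysis.Analysis" "HOL-Library.Poly_Mapping" "HOL-Algebra.Algebraic_Closure_Type"
begin

text \<open>
  The index type \<open>'d::finite\<close> plays the role of \<open>{1,\<dots>,d}\<close>; its cardinality is an arbitrary
  positive integer. The family \<open>M\<close> consists of subsets of the real line.
\<close>

definition exponents :: "('d \<Rightarrow> real set) \<Rightarrow> (real ^ 'd) set" where
  "exponents M = {m. \<forall>i. m $ i \<in> M i \<and> 0 \<le> m $ i}"

text \<open>
  Addition and multiplication of finitely supported functions in \<^type>\<open>poly_mapping\<close> are pointwise
  addition and convolution, so the type \<open>real ^ 'd \<Rightarrow>\<^sub>0 'a\<close> is the group ring of all of \<open>\<real>\<^sup>d\<close>; the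
  semigroup ring is the subring of those functions whose support lies in \<^term>\<open>exponents M\<close>.
\<close>

definition semigroup_ring :: "('d::finite \<Rightarrow> real set) \<Rightarrow> (real ^ 'd \<Rightarrow>\<^sub>0 'a::comm_ring_1) ring" where
  "semigroup_ring M = ring_of_type_algebra\<lparr>carrier := {f. Poly_Mapping.keys f \<subseteq> exponents M}\<rparr>"

definition X_pow :: "real ^ 'd \<Rightarrow> (real ^ 'd \<Rightarrow>\<^sub>0 'a::comm_ring_1)" where
  "X_pow m = Poly_Mapping.single m 1"

definition monomial_ideal :: "('d::finite \<Rightarrow> real set) \<Rightarrow> (real ^ 'd \<Rightarrow>\<^sub>0 'a::comm_ring_1) set \<Rightarrow> bool" where
  "monomial_ideal M I \<longleftrightarrow> (\<exists>S \<subseteq> exponents M. I = genideal (semigroup_ring M) (X_pow ` S))"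

text \<open>The finitely many generators are arbitrary ring elements, not necessarily monomials.\<close>

definition fin_gen_ideal :: "'r ring \<Rightarrow> 'r set \<Rightarrow> bool" where
  "fin_gen_ideal R I \<longleftrightarrow> (\<exists>S \<subseteq> carrier R. finite S \<and> I = genideal R S)"

definition nonzero_fg_monomial_ideals ::
  "('d::finite \<Rightarrow> real set) \<Rightarrow> (real ^ 'd \<Rightarrow>\<^sub>0 'a::comm_ring_1) set set" where
  "nonzero_fg_monomial_ideals M =
     {I. monomial_ideal M I \<and> fin_gen_ideal (semigroup_ring M) I \<and> I \<noteq> {0}}"

definition close_ideals ::
  "('d::finite \<Rightarrow> real set) \<Rightarrow> (real ^ 'd \<Rightarrow>\<^sub>0 'a::comm_ring_1) set \<Rightarrow> (real ^ 'd \<Rightarrow>\<^sub>0 'a) set \<Rightarrow> real \<Rightarrow> bool" where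
  "close_ideals M I J \<epsilon> \<longleftrightarrow>
     (\<forall>\<gamma> \<in> exponents M. X_pow \<gamma> \<in> I \<longrightarrow> (\<exists>\<delta> \<in> exponents M. X_pow \<delta> \<in> J \<and> norm (\<gamma> - \<delta>) < \<epsilon>)) \<and>
     (\<forall>\<delta> \<in> exponents M. X_pow \<delta> \<in> J \<longrightarrow> (\<exists>\<gamma> \<in> exponents M. X_pow \<gamma> \<in> I \<and> norm (\<delta> - \<gamma>) < \<epsilon>))"

text \<open>
  The infimum is taken in the extended reals, so that the distance is \<open>\<infinity>\<close> if no \<open>\<epsilon>\<close> is admissible
  (the infimum of the empty set of reals would be an unspecified number).
\<close>

definition ideal_dist ::
  "('d::finite \<Rightarrow> real set) \<Rightarrow> (real ^ 'd \<Rightarrow>\<^sub>0 'a::comm_ring_1) set \<Rightarrow> (real ^ 'd \<Rightarrow>\<^sub>0 'a) set \<Rightarrow> ereal" where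
  "ideal_dist M I J = Inf (ereal ` {\<epsilon>. 0 < \<epsilon> \<and> close_ideals M I J \<epsilon>})"

end

theory Submission
  imports Defs
begin

text \<open>
  Everything about a monomial ideal \<open>I\<close> that matters here is carried by the set of exponents of the
  monomials in it. If \<open>I\<close> is generated by the monomials with exponents in \<open>S\<close>, this set is
  \<open>S + E\<close>, where \<open>E\<close> is the monoid of all exponents, and \<open>I\<close> is recovered from it because \<open>I\<close> is
  generated by its monomials. The distance is the Hausdorff distance of the exponent sets, so
  symmetry and the triangle inequality hold as they do for every Hausdorff distance.

  The two remaining points use finite generation. The exponents in the supports of finitely many
  generators form a finite set \<open>T\<close>, nonempty if \<open>I \<noteq> 0\<close>, and the exponent set of \<open>I\<close> is \<open>T + E\<close>
  (lemma \<open>finite_exponent_generators\<close>).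

  \<^item> The distance is finite: moving \<open>t + e\<close> to \<open>t' + e\<close> costs only \<open>|t - t'|\<close>, and there are only
    finitely many pairs \<open>(t, t')\<close> (lemma \<open>finite_sets_bounded_shift\<close>).

  \<^item> Distance zero forces equality: \<open>T + E\<close> consists of the exponents in \<open>T + O\<close>, where \<open>O\<close> is the
    closed orthant of nonnegative vectors, because the difference of two exponents is again an
    exponent as soon as it is nonnegative. A finite union of translates of \<open>O\<close> is closed, so an
    exponent that is a limit of elements of \<open>T + E\<close> belongs to \<open>T + E\<close> itself. For infinite \<open>T\<close>
    this fails: with \<open>d = 1\<close> and \<open>M = \<real>\<close>, the ideal generated by all \<open>X\<^sup>r\<close>, \<open>r > 0\<close>, is at distance
    zero from the unit ideal.
\<close>


section \<open>Exponent sets and the semigroup ring\<close>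

definition ideal_exponents ::
  "('d::finite \<Rightarrow> real set) \<Rightarrow> (real ^ 'd \<Rightarrow>\<^sub>0 'a::comm_ring_1) set \<Rightarrow> (real ^ 'd) set" where
  "ideal_exponents M I = {\<gamma> \<in> exponents M. X_pow \<gamma> \<in> I}"

definition generated_exponents ::
  "('d::finite \<Rightarrow> real set) \<Rightarrow> (real ^ 'd) set \<Rightarrow> (real ^ 'd) set" where
  "generated_exponents M S = {s + e | s e. s \<in> S \<and> e \<in> exponents M}"

lemma generated_exponentsI:
  "s \<in> S \<Longrightarrow> e \<in> exponents M \<Longrightarrow> s + e \<in> generated_exponents M S"
  by (auto simp: generated_exponents_def)

lemma generated_exponentsE:
  assumes "x \<in> generated_exponents M S"
  obtains s e where "s \<in> S" "e \<in> exponents M" "x = s + e"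
  using assms by (auto simp: generated_exponents_def)

lemma keys_X_pow [simp]:
  "Poly_Mapping.keys (X_pow m :: real ^ 'd \<Rightarrow>\<^sub>0 'a::comm_ring_1) = {m}"
  by (simp add: X_pow_def)

lemma X_pow_add: "X_pow (a + b) = X_pow a * X_pow b"
  by (simp add: X_pow_def mult_single)

lemma semigroup_ring_simps [simp]:
  "carrier (semigroup_ring M) = {f. Poly_Mapping.keys f \<subseteq> exponents M}"
  "mult (semigroup_ring M) f g = f * g"
  "add (semigroup_ring M) f g = f + g"
  "\<zero>\<^bsub>semigroup_ring M\<^esub> = 0"
  "\<one>\<^bsub>semigroup_ring M\<^esub> = 1"
  by (simp_all add: semigroup_ring_def ring_of_type_algebra_def)

lemma X_pow_in_semigroup_ring: "S \<subseteq> exponents M \<Longrightarrow> X_pow ` S \<subseteq> carrier (semigroup_ring M)"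
  by auto


section \<open>Exponents of monomial ideals\<close>

locale exponent_groups =
  fixes M :: "'d::finite \<Rightarrow> real set"
  assumes subgroups: "\<And>i. additive_subgroup (M i) (ring_of_type_algebra :: real ring)"
begin

lemma zero_in_group: "0 \<in> M i"
  using additive_subgroup.zero_closed[OF subgroups[of i]]
  by (simp add: ring_of_type_algebra_def)

lemma add_in_group: "x \<in> M i \<Longrightarrow> y \<in> M i \<Longrightarrow> x + y \<in> M i"
  using additive_subgroup.a_closed[OF subgroups[of i], of x y]
  by (simp add: ring_of_type_algebra_def)

lemma uminus_in_group:
  assumes "x \<in> M i"
  shows "- x \<in> M i"
proof -
  let ?R = "ring_of_type_algebra :: real ring"
  interpret R: ring ?R
    by (rule ring_from_type_algebra)
  have "\<ominus>\<^bsub>?R\<^esub> x \<in> M i"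
    using subgroup.m_inv_closed[OF additive_subgroup.a_subgroup[OF subgroups[of i]] assms]
    by (simp add: a_inv_def)
  moreover have "x + \<ominus>\<^bsub>?R\<^esub> x = 0"
    using R.r_neg[of x] by (simp add: ring_of_type_algebra_def)
  then have "\<ominus>\<^bsub>?R\<^esub> x = - x"
    by simp
  ultimately show ?thesis
    by simp
qed

lemma zero_in_exponents: "0 \<in> exponents M"
  by (simp add: exponents_def zero_in_group)

lemma add_in_exponents: "a \<in> exponents M \<Longrightarrow> b \<in> exponents M \<Longrightarrow> a + b \<in> exponents M"
  by (simp add: exponents_def add_in_group)

lemma diff_in_exponents:
  fixes a b :: "real ^ 'd"
  assumes "a \<in> exponents M" "b \<in> exponents M" "\<And>i. b $ i \<le> a $ i"
  shows "a - b \<in> exponents M"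
  using assms add_in_group[OF _ uminus_in_group] by (fastforce simp: exponents_def)

text \<open>
  The exponents form the nonnegative part of a group. Hence whether an exponent belongs to \<open>S + E\<close>
  depends only on coordinatewise comparison with the elements of \<open>S\<close>. This description in terms of
  inequalities is what makes the topological argument on limits possible.
\<close>

lemma generated_exponents_iff:
  fixes x :: "real ^ 'd"
  assumes "S \<subseteq> exponents M"
  shows "x \<in> generated_exponents M S \<longleftrightarrow> x \<in> exponents M \<and> (\<exists>s\<in>S. \<forall>i. s $ i \<le> x $ i)"
proof
  assume "x \<in> generated_exponents M S"
  then obtain s e where "s \<in> S" "e \<in> exponents M" "x = s + e"
    by (rule generated_exponentsE)
  moreover from this have "x \<in> exponents M"
    using assms add_in_exponents by blast
  ultimately show "x \<in> exponents M \<and> (\<exists>s\<in>S. \<forall>i. s $ i \<le> x $ i)"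
    by (auto simp: exponents_def intro!: bexI[of _ s])
next
  assume "x \<in> exponents M \<and> (\<exists>s\<in>S. \<forall>i. s $ i \<le> x $ i)"
  then obtain s where "x \<in> exponents M" "s \<in> S" "\<forall>i. s $ i \<le> x $ i"
    by blast
  then have "x - s \<in> exponents M"
    using assms by (auto intro: diff_in_exponents)
  then show "x \<in> generated_exponents M S"
    using generated_exponentsI[OF \<open>s \<in> S\<close>] by fastforce
qed

lemma subset_generated_exponents: "S \<subseteq> generated_exponents M S"
  using generated_exponentsI[OF _ zero_in_exponents] by fastforce

lemma generated_exponents_add:
  assumes "x \<in> generated_exponents M S" "e \<in> exponents M"
  shows "x + e \<in> generated_exponents M S"
proof -
  obtain s e' where "s \<in> S" "e' \<in> exponents M" "x = s + e'"
    using assms(1) by (rule generated_exponentsE)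
  then show ?thesis
    using generated_exponentsI[OF _ add_in_exponents[OF _ assms(2)], of s S e']
    by (simp add: add.assoc)
qed

lemma generated_exponents_subset: "S \<subseteq> exponents M \<Longrightarrow> generated_exponents M S \<subseteq> exponents M"
  by (auto simp: generated_exponents_iff)

lemma semigroup_ring_is_ring: "ring (semigroup_ring M :: (real ^ 'd \<Rightarrow>\<^sub>0 'a::comm_ring_1) ring)"
proof -
  let ?P = "ring_of_type_algebra :: (real ^ 'd \<Rightarrow>\<^sub>0 'a) ring"
  let ?H = "{f :: real ^ 'd \<Rightarrow>\<^sub>0 'a. Poly_Mapping.keys f \<subseteq> exponents M}"
  interpret P: ring ?P
    by (rule ring_from_type_algebra)
  have minus: "\<ominus>\<^bsub>?P\<^esub> f = - f" for f
  proof -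
    have "f + \<ominus>\<^bsub>?P\<^esub> f = 0"
      using P.r_neg[of f] by (simp add: ring_of_type_algebra_def)
    then show ?thesis
      by (metis minus_unique)
  qed
  have "subring ?H ?P"
  proof (rule P.subringI)
    show "\<one>\<^bsub>?P\<^esub> \<in> ?H"
      by (simp add: ring_of_type_algebra_def zero_in_exponents)
    show "f \<otimes>\<^bsub>?P\<^esub> g \<in> ?H" if "f \<in> ?H" "g \<in> ?H" for f g
      using that keys_mult[of f g] add_in_exponents
      by (fastforce simp: ring_of_type_algebra_def)
    show "f \<oplus>\<^bsub>?P\<^esub> g \<in> ?H" if "f \<in> ?H" "g \<in> ?H" for f g
      using that keys_add[of f g] by (auto simp: ring_of_type_algebra_def)
    show "\<ominus>\<^bsub>?P\<^esub> f \<in> ?H" if "f \<in> ?H" for f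
      using that by (simp add: minus)
  qed (simp add: ring_of_type_algebra_def)
  then show ?thesis
    unfolding semigroup_ring_def by (rule P.subring_is_ring)
qed

text \<open>
  The set \<open>S + E\<close> is stable under adding exponents. Therefore, the restriction that supports lie in
  \<open>S + E\<close> survives multiplication by ring elements. This bounds from above the ideal generated by any
  elements with supports in \<open>S + E\<close>, monomials or not.
\<close>

lemma ideal_of_support:
  assumes "S \<subseteq> exponents M"
  shows "ideal {f :: real ^ 'd \<Rightarrow>\<^sub>0 'a::comm_ring_1. Poly_Mapping.keys f \<subseteq> generated_exponents M S}
    (semigroup_ring M)"
    (is "ideal ?I ?R")
proof (rule idealI)
  interpret R: ring ?R
    by (rule semigroup_ring_is_ring)
  show "ring ?R"
    by (rule semigroup_ring_is_ring)
  have minus: "\<ominus>\<^bsub>?R\<^esub> f = - f" if "Poly_Mapping.keys f \<subseteq> exponents M" for f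
  proof -
    have "f + \<ominus>\<^bsub>?R\<^esub> f = 0"
      using R.r_neg[of f] that by simp
    then show ?thesis
      by (metis minus_unique)
  qed
  show "subgroup ?I (add_monoid ?R)"
  proof (rule R.add.subgroupI)
    show "?I \<subseteq> carrier ?R"
      using generated_exponents_subset[OF assms] by auto
    have "0 \<in> ?I"
      by simp
    then show "?I \<noteq> {}"
      by (rule ex_in_conv[THEN iffD1, OF exI])
    show "\<ominus>\<^bsub>?R\<^esub> f \<in> ?I" if "f \<in> ?I" for f
    proof -
      have "\<ominus>\<^bsub>?R\<^esub> f = - f"
        using that generated_exponents_subset[OF assms] by (intro minus) blast
      then show ?thesis
        using that by simp
    qed
    show "f \<oplus>\<^bsub>?R\<^esub> g \<in> ?I" if "f \<in> ?I" "g \<in> ?I" for f g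
    proof -
      have "Poly_Mapping.keys (f + g) \<subseteq> generated_exponents M S"
        using that keys_add[of f g] by blast
      then show ?thesis
        by simp
    qed
  qed
  have closed: "f * g \<in> ?I" if "f \<in> ?I" "g \<in> carrier ?R" for f g
  proof -
    have "Poly_Mapping.keys (f * g) \<subseteq> generated_exponents M S"
    proof
      fix x
      assume "x \<in> Poly_Mapping.keys (f * g)"
      then obtain a b where "x = a + b" "a \<in> Poly_Mapping.keys f" "b \<in> Poly_Mapping.keys g"
        using keys_mult[of f g] by auto
      then show "x \<in> generated_exponents M S"
        using that generated_exponents_add[of a S b] by auto
    qed
    then show ?thesis
      by simp
  qed
  show "f \<otimes>\<^bsub>?R\<^esub> g \<in> ?I" if "f \<in> ?I" "g \<in> carrier ?R" for f g
    using closed[OF that] by simp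
  show "g \<otimes>\<^bsub>?R\<^esub> f \<in> ?I" if "f \<in> ?I" "g \<in> carrier ?R" for f g
    using closed[OF that] by (simp add: mult.commute)
qed

lemma keys_genideal_subset:
  fixes F :: "(real ^ 'd \<Rightarrow>\<^sub>0 'a::comm_ring_1) set"
  assumes "S \<subseteq> exponents M" "\<And>f. f \<in> F \<Longrightarrow> Poly_Mapping.keys f \<subseteq> generated_exponents M S"
    and "f \<in> genideal (semigroup_ring M) F"
  shows "Poly_Mapping.keys f \<subseteq> generated_exponents M S"
  using ring.genideal_minimal[OF semigroup_ring_is_ring ideal_of_support[OF assms(1)], of F]
    assms(2,3) by blast

lemma ideal_exponents_add:
  assumes I: "ideal I (semigroup_ring M)"
    and "x \<in> ideal_exponents M I" "e \<in> exponents M"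
  shows "x + e \<in> ideal_exponents M I"
  using assms ideal.I_r_closed[OF I, of "X_pow x" "X_pow e"] add_in_exponents
  by (auto simp: ideal_exponents_def X_pow_add)

lemma generated_subset_ideal_exponents:
  assumes "ideal I (semigroup_ring M)" "S \<subseteq> ideal_exponents M I"
  shows "generated_exponents M S \<subseteq> ideal_exponents M I"
  using assms ideal_exponents_add by (blast elim: generated_exponentsE)

lemma monomial_ideal_is_ideal: "monomial_ideal M I \<Longrightarrow> ideal I (semigroup_ring M)"
  unfolding monomial_ideal_def
  using ring.genideal_ideal[OF semigroup_ring_is_ring X_pow_in_semigroup_ring] by blast

text \<open>
  A monomial ideal contains every monomial that occurs in one of its elements: these monomials are
  multiples of monomial generators.
\<close>

lemma keys_in_ideal_exponents:
  fixes I :: "(real ^ 'd \<Rightarrow>\<^sub>0 'a::comm_ring_1) set"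
  assumes "monomial_ideal M I" "f \<in> I"
  shows "Poly_Mapping.keys f \<subseteq> ideal_exponents M I"
proof -
  obtain S where S: "S \<subseteq> exponents M" "I = genideal (semigroup_ring M) (X_pow ` S)"
    using assms(1) by (auto simp: monomial_ideal_def)
  have "Poly_Mapping.keys f \<subseteq> generated_exponents M S"
  proof (rule keys_genideal_subset[OF S(1)])
    show "f \<in> genideal (semigroup_ring M) (X_pow ` S)"
      using assms(2) S(2) by simp
    show "Poly_Mapping.keys g \<subseteq> generated_exponents M S"
      if "g \<in> X_pow ` S" for g :: "real ^ 'd \<Rightarrow>\<^sub>0 'a"
      using that subset_generated_exponents[of S] by auto
  qed
  also have "\<dots> \<subseteq> ideal_exponents M I"
  proof (rule generated_subset_ideal_exponents[OF monomial_ideal_is_ideal[OF assms(1)]])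
    have "X_pow ` S \<subseteq> I"
      unfolding S(2)
      by (rule ring.genideal_self[OF semigroup_ring_is_ring X_pow_in_semigroup_ring[OF S(1)]])
    then show "S \<subseteq> ideal_exponents M I"
      using S(1) by (auto simp: ideal_exponents_def)
  qed
  finally show ?thesis .
qed

lemma monomial_ideal_mono:
  fixes I J :: "(real ^ 'd \<Rightarrow>\<^sub>0 'a::comm_ring_1) set"
  assumes "monomial_ideal M I" "monomial_ideal M J" "ideal_exponents M I \<subseteq> ideal_exponents M J"
  shows "I \<subseteq> J"
proof -
  obtain S where S: "S \<subseteq> exponents M" "I = genideal (semigroup_ring M) (X_pow ` S)"
    using assms(1) by (auto simp: monomial_ideal_def)
  have "X_pow ` S \<subseteq> I"
    unfolding S(2)
    by (rule ring.genideal_self[OF semigroup_ring_is_ring X_pow_in_semigroup_ring[OF S(1)]])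
  then have "X_pow ` S \<subseteq> J"
    using S(1) assms(3) by (auto simp: ideal_exponents_def)
  then show ?thesis
    unfolding S(2)
    by (rule ring.genideal_minimal[OF semigroup_ring_is_ring monomial_ideal_is_ideal[OF assms(2)]])
qed

text \<open>
  The given generators need not be monomials. The supports of all of them together contain only
  finitely many exponents; the corresponding monomials lie in the ideal, and they generate it
  because they generate the given generators.
\<close>

lemma finite_exponent_generators:
  fixes I :: "(real ^ 'd \<Rightarrow>\<^sub>0 'a::comm_ring_1) set"
  assumes "I \<in> nonzero_fg_monomial_ideals M"
  obtains T where "finite T" "T \<noteq> {}" "T \<subseteq> exponents M"
    "ideal_exponents M I = generated_exponents M T"
proof -
  have mono: "monomial_ideal M I" and "I \<noteq> {0}"
    using assms by (auto simp: nonzero_fg_monomial_ideals_def)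
  note I = monomial_ideal_is_ideal[OF mono]
  obtain F where F: "F \<subseteq> carrier (semigroup_ring M)" "finite F" "I = genideal (semigroup_ring M) F"
    using assms by (auto simp: nonzero_fg_monomial_ideals_def fin_gen_ideal_def)
  define T where "T = (\<Union>f\<in>F. Poly_Mapping.keys f)"
  have "finite T"
    unfolding T_def using F(2) by simp
  have "F \<subseteq> I"
    unfolding F(3) by (rule ring.genideal_self[OF semigroup_ring_is_ring F(1)])
  then have T_subset: "T \<subseteq> ideal_exponents M I"
    unfolding T_def using keys_in_ideal_exponents[OF mono] by blast
  then have T_exp: "T \<subseteq> exponents M"
    by (auto simp: ideal_exponents_def)
  have keys_I: "Poly_Mapping.keys f \<subseteq> generated_exponents M T" if "f \<in> I" for f
  proof (rule keys_genideal_subset[OF T_exp])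
    show "f \<in> genideal (semigroup_ring M) F"
      using that F(3) by simp
    show "Poly_Mapping.keys g \<subseteq> generated_exponents M T" if "g \<in> F" for g
      using that subset_generated_exponents[of T] by (auto simp: T_def)
  qed
  have "ideal_exponents M I \<subseteq> generated_exponents M T"
    using keys_I by (fastforce simp: ideal_exponents_def)
  then have "ideal_exponents M I = generated_exponents M T"
    using generated_subset_ideal_exponents[OF I T_subset] by blast
  moreover have "T \<noteq> {}"
  proof -
    have "0 \<in> I"
      using additive_subgroup.zero_closed[OF ideal.axioms(1)[OF I]] by simp
    then obtain f where "f \<in> I" "f \<noteq> 0"
      using \<open>I \<noteq> {0}\<close> by blast
    then have "generated_exponents M T \<noteq> {}"
      using keys_I keys_eq_empty by blast
    then show ?thesis
      by (auto simp: generated_exponents_def)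
  qed
  ultimately show thesis
    using that \<open>finite T\<close> T_exp by blast
qed

end


section \<open>Hausdorff distance of finitely generated exponent sets\<close>

lemma close_ideals_iff:
  "close_ideals M I J \<epsilon> \<longleftrightarrow>
     (\<forall>\<gamma>\<in>ideal_exponents M I. \<exists>\<delta>\<in>ideal_exponents M J. dist \<gamma> \<delta> < \<epsilon>) \<and>
     (\<forall>\<delta>\<in>ideal_exponents M J. \<exists>\<gamma>\<in>ideal_exponents M I. dist \<delta> \<gamma> < \<epsilon>)"
  by (simp add: close_ideals_def ideal_exponents_def dist_norm Ball_def Bex_def imp_conjL conj_assoc)

lemma close_ideals_sym: "close_ideals M I J \<epsilon> \<longleftrightarrow> close_ideals M J I \<epsilon>"
  unfolding close_ideals_iff by (rule conj_commute)

lemma close_ideals_refl: "0 < \<epsilon> \<Longrightarrow> close_ideals M I I \<epsilon>"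
  unfolding close_ideals_iff by (metis dist_self)

lemma close_ideals_triangle:
  assumes "close_ideals M I J \<epsilon>\<^sub>1" "close_ideals M J K \<epsilon>\<^sub>2"
  shows "close_ideals M I K (\<epsilon>\<^sub>1 + \<epsilon>\<^sub>2)"
proof -
  have chain: "\<exists>z\<in>C. dist x z < a + b"
    if near: "x \<in> A" "\<forall>x\<in>A. \<exists>y\<in>B. dist x y < a" "\<forall>y\<in>B. \<exists>z\<in>C. dist y z < b"
    for A B C :: "(real ^ 'a) set" and x a b
  proof -
    obtain y z where "y \<in> B" "dist x y < a" "z \<in> C" "dist y z < b"
      using near by blast
    then show ?thesis
      using dist_triangle[of x z y] by (intro bexI[of _ z]) auto
  qed
  let ?X = "ideal_exponents M"
  have "\<forall>x\<in>?X I. \<exists>z\<in>?X K. dist x z < \<epsilon>\<^sub>1 + \<epsilon>\<^sub>2"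
    using assms unfolding close_ideals_iff by (intro ballI chain[of _ _ "?X J"]) auto
  moreover have "\<forall>x\<in>?X K. \<exists>z\<in>?X I. dist x z < \<epsilon>\<^sub>2 + \<epsilon>\<^sub>1"
    using assms unfolding close_ideals_iff by (intro ballI chain[of _ _ "?X J"]) auto
  ultimately show ?thesis
    unfolding close_ideals_iff by (simp add: add.commute)
qed

text \<open>
  Closedness of the set of vectors above some element of \<open>T\<close> is what makes the distance separate
  ideals; it rests on the finiteness of \<open>T\<close>.
\<close>

lemma closed_above_finite:
  assumes "finite T"
  shows "closed {x :: real ^ 'd::finite. \<exists>t\<in>T. \<forall>i. t $ i \<le> x $ i}"
proof -
  have "closed {x :: real ^ 'd. \<forall>i. t $ i \<le> x $ i}" for t :: "real ^ 'd"
    by (intro closed_Collect_all closed_Collect_le continuous_intros)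
  then have "closed (\<Union>t\<in>T. {x :: real ^ 'd. \<forall>i. t $ i \<le> x $ i})"
    using assms by (intro closed_UN) auto
  also have "(\<Union>t\<in>T. {x. \<forall>i. t $ i \<le> x $ i}) = {x. \<exists>t\<in>T. \<forall>i. t $ i \<le> x $ i}"
    by blast
  finally show ?thesis .
qed

text \<open>
  To pass from \<open>T + E\<close> to \<open>T' + E\<close>, replace the summand from \<open>T\<close> by one fixed element of \<open>T'\<close>
  and keep the summand from \<open>E\<close>. The displacement is then a difference of generators, and these are
  bounded because there are finitely many.
\<close>

lemma finite_sets_bounded_shift:
  assumes "finite T" "finite T'" "T' \<noteq> {}"
  shows "\<exists>B>0. \<forall>x\<in>generated_exponents M T. \<exists>y\<in>generated_exponents M T'. dist x y < B"
proof -
  have "bounded ((\<lambda>(t, t'). dist t t') ` (T \<times> T'))"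
    using assms by (intro finite_imp_bounded) simp
  then obtain B where "0 < B" and B: "\<And>t t'. t \<in> T \<Longrightarrow> t' \<in> T' \<Longrightarrow> dist t t' \<le> B"
    unfolding bounded_pos by fastforce
  obtain t' where "t' \<in> T'"
    using assms(3) by blast
  have "\<exists>y\<in>generated_exponents M T'. dist x y < B + 1"
    if x: "x \<in> generated_exponents M T" for x
  proof -
    obtain t e where "t \<in> T" "e \<in> exponents M" "x = t + e"
      using x by (rule generated_exponentsE)
    moreover have "t' + e \<in> generated_exponents M T'"
      using \<open>t' \<in> T'\<close> \<open>e \<in> exponents M\<close> by (rule generated_exponentsI)
    moreover have "dist (t + e) (t' + e) < B + 1"
      using B[OF \<open>t \<in> T\<close> \<open>t' \<in> T'\<close>] by (simp add: dist_norm)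
    ultimately show ?thesis
      by blast
  qed
  then show ?thesis
    using \<open>0 < B\<close> by (intro exI[of _ "B + 1"]) simp
qed

section \<open>The distance as a metric\<close>

context exponent_groups
begin

lemma ex_close_ideals:
  assumes "I \<in> nonzero_fg_monomial_ideals M" "J \<in> nonzero_fg_monomial_ideals M"
  shows "\<exists>\<epsilon>>0. close_ideals M I J \<epsilon>"
proof -
  obtain T where T: "finite T" "T \<noteq> {}" "ideal_exponents M I = generated_exponents M T"
    using finite_exponent_generators[OF assms(1)] .
  obtain T' where T': "finite T'" "T' \<noteq> {}" "ideal_exponents M J = generated_exponents M T'"
    using finite_exponent_generators[OF assms(2)] .
  obtain B where B: "0 < B"
    "\<forall>x\<in>generated_exponents M T. \<exists>y\<in>generated_exponents M T'. dist x y < B"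
    using finite_sets_bounded_shift[OF T(1) T'(1,2)] by blast
  obtain B' where B': "0 < B'"
    "\<forall>x\<in>generated_exponents M T'. \<exists>y\<in>generated_exponents M T. dist x y < B'"
    using finite_sets_bounded_shift[OF T'(1) T(1,2)] by blast
  have "close_ideals M I J (max B B')"
    unfolding close_ideals_iff T(3) T'(3) less_max_iff_disj using B(2) B'(2) by blast
  then show ?thesis
    using B(1) by (intro exI[of _ "max B B'"]) simp
qed

text \<open>
  An exponent of \<open>I\<close> is a limit of exponents of \<open>J\<close>, hence lies above one of the finitely many
  generators of \<open>J\<close>. Lying above it makes the exponent a member of \<open>T + E\<close>.
\<close>

lemma ideal_exponents_subset_if_close:
  assumes J: "J \<in> nonzero_fg_monomial_ideals M"
    and close: "\<And>\<epsilon>. 0 < \<epsilon> \<Longrightarrow> close_ideals M I J \<epsilon>"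
  shows "ideal_exponents M I \<subseteq> ideal_exponents M J"
proof
  fix x
  assume x: "x \<in> ideal_exponents M I"
  obtain T where T: "finite T" "T \<subseteq> exponents M" "ideal_exponents M J = generated_exponents M T"
    using finite_exponent_generators[OF J] .
  let ?U = "{x :: real ^ 'd. \<exists>t\<in>T. \<forall>i. t $ i \<le> x $ i}"
  have "\<exists>y\<in>?U. dist y x < \<epsilon>" if "0 < \<epsilon>" for \<epsilon>
  proof -
    obtain y where "y \<in> generated_exponents M T" "dist x y < \<epsilon>"
      using close[OF \<open>0 < \<epsilon>\<close>] x unfolding close_ideals_iff T(3) by blast
    then show ?thesis
      using generated_exponents_iff[OF T(2), of y] by (intro bexI[of _ y]) (auto simp: dist_commute)
  qed
  then have "x \<in> closure ?U"
    by (simp add: closure_approachable)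
  then have "x \<in> ?U"
    using closed_above_finite[OF T(1)] by simp
  then show "x \<in> ideal_exponents M J"
    using x T(3) generated_exponents_iff[OF T(2)] by (auto simp: ideal_exponents_def)
qed

end

lemma ideal_dist_nonneg: "0 \<le> ideal_dist M I J"
  by (auto simp: ideal_dist_def intro!: Inf_greatest)

lemma ideal_dist_sym: "ideal_dist M I J = ideal_dist M J I"
  by (simp add: ideal_dist_def close_ideals_sym[of M I J])

lemma ideal_dist_le: "0 < \<epsilon> \<Longrightarrow> close_ideals M I J \<epsilon> \<Longrightarrow> ideal_dist M I J \<le> ereal \<epsilon>"
  by (auto simp: ideal_dist_def intro!: Inf_lower)

lemma ideal_dist_less_iff:
  "ideal_dist M I J < ereal r \<longleftrightarrow> (\<exists>\<epsilon>>0. \<epsilon> < r \<and> close_ideals M I J \<epsilon>)"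
  by (auto simp: ideal_dist_def Inf_less_iff)

lemma ideal_dist_refl: "ideal_dist M I I = 0"
proof (rule antisym[OF _ ideal_dist_nonneg])
  show "ideal_dist M I I \<le> 0"
    by (rule ereal_le_epsilon2) (auto intro: ideal_dist_le close_ideals_refl)
qed

text \<open>
  The infimum need not be attained. The two admissible numbers are therefore chosen within
  \<open>\<epsilon> / 2\<close> of the distances, and \<open>\<epsilon>\<close> tends to zero.
\<close>

lemma ideal_dist_triangle:
  assumes "ideal_dist M I J = ereal a" "ideal_dist M J K = ereal b"
  shows "ideal_dist M I K \<le> ereal (a + b)"
proof (rule ereal_le_epsilon2)
  fix \<epsilon> :: real
  assume "0 < \<epsilon>"
  then have "ideal_dist M I J < ereal (a + \<epsilon> / 2)" "ideal_dist M J K < ereal (b + \<epsilon> / 2)"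
    using assms by auto
  then obtain r s where "0 < r" "r < a + \<epsilon> / 2" "close_ideals M I J r"
    and "0 < s" "s < b + \<epsilon> / 2" "close_ideals M J K s"
    unfolding ideal_dist_less_iff by blast
  then have "ideal_dist M I K \<le> ereal (r + s)"
    by (intro ideal_dist_le close_ideals_triangle) auto
  also have "\<dots> \<le> ereal (a + b) + ereal \<epsilon>"
    using \<open>r < a + \<epsilon> / 2\<close> \<open>s < b + \<epsilon> / 2\<close> by simp
  finally show "ideal_dist M I K \<le> ereal (a + b) + ereal \<epsilon>" .
qed

lemma close_if_ideal_dist_zero:
  assumes "ideal_dist M I J = 0" "0 < \<epsilon>"
  shows "close_ideals M I J \<epsilon>"
proof -
  have "ideal_dist M I J < ereal \<epsilon>"
    using assms by simp
  then obtain r where "r < \<epsilon>" "close_ideals M I J r"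
    unfolding ideal_dist_less_iff by blast
  then show ?thesis
    unfolding close_ideals_iff by (meson less_trans)
qed

theorem theorem4p13:
  fixes M :: "'d::finite \<Rightarrow> real set"
  assumes "\<And>i. additive_subgroup (M i) (ring_of_type_algebra :: real ring)"
    and "\<And>i. M i \<noteq> {0}"
  defines "C \<equiv> (nonzero_fg_monomial_ideals M :: (real ^ 'd \<Rightarrow>\<^sub>0 'a::comm_ring_1) set set)"
  shows "(\<forall>I \<in> C. \<forall>J \<in> C. ideal_dist M I J \<noteq> \<infinity>) \<and>
         Metric_space C (\<lambda>I J. real_of_ereal (ideal_dist M I J))"
proof -
  interpret exponent_groups M
    by (rule exponent_groups.intro) (rule assms(1))
  let ?d = "\<lambda>I J :: (real ^ 'd \<Rightarrow>\<^sub>0 'a) set. real_of_ereal (ideal_dist M I J)"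
  have finite_dist: "ideal_dist M I J \<noteq> \<infinity>" if "I \<in> C" "J \<in> C" for I J
    using ex_close_ideals[of I J] that ideal_dist_le[of _ M I J] by (auto simp: C_def)
  have real_dist: "ideal_dist M I J = ereal (?d I J)" if "I \<in> C" "J \<in> C" for I J
    using finite_dist[OF that] ideal_dist_nonneg[of M I J] by (simp add: ereal_real)
  have "Metric_space C ?d"
  proof
    show "0 \<le> ?d I J" for I J
      by (simp add: ideal_dist_nonneg real_of_ereal_pos)
    show "?d I J = ?d J I" for I J
      by (simp add: ideal_dist_sym)
    show "?d I J = 0 \<longleftrightarrow> I = J" if IJ: "I \<in> C" "J \<in> C" for I J
    proof
      assume "?d I J = 0"
      then have zero: "ideal_dist M I J = 0" "ideal_dist M J I = 0"
        using real_dist[OF IJ] by (simp_all add: ideal_dist_sym zero_ereal_def)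
      have "ideal_exponents M I = ideal_exponents M J"
        using IJ zero unfolding C_def
        by (intro equalityI ideal_exponents_subset_if_close close_if_ideal_dist_zero)
      then show "I = J"
        using IJ monomial_ideal_mono[of I J] monomial_ideal_mono[of J I]
        by (auto simp: C_def nonzero_fg_monomial_ideals_def)
    qed (simp add: ideal_dist_refl)
    show "?d I K \<le> ?d I J + ?d J K" if "I \<in> C" "J \<in> C" "K \<in> C" for I J K
      using ideal_dist_triangle[OF real_dist[of I J] real_dist[of J K]] real_dist[of I K] that
      by (metis ereal_less_eq(3))
  qed
  then show ?thesis
    using finite_dist by blast
qed

end
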